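(* For all finite simple graphs $G$ and $H$, $$\pi(G\circ H)\leq \pi(H)+\bigl(|V(G)|-\alpha(G)\bigr)\,|V(H)|,$$ where $G\circ H$ is the lexicographic product, $\pi$ is the Thue chromatic number and $\alpha(G)$ is the independence number of $G$.
   Context: A repetition is a sequence $r_1\ldots r_{2n}$ with $n\ge 1$ and $r_i=r_{n+i}$ for all $1\le i\le n$. A vertex colouring $\varphi$ of a simple graph $G$ is non-repetitive if for every $n\ge 1$ and every simple path (distinct vertices, consecutive ones adjacent) $v_1\ldots v_{2n}$ in $G$, the colour sequence $\varphi(v_1)\ldots\varphi(v_{2n})$ is not a repetition (the case $n=1$ says that $\varphi$ is a proper colouring). The Thue chromatic number $\pi(G)$ is the minimum number of colours in a non-repetitive colouring of $G$. The lexicographic product $G\circ H$ has vertex set $V(G)\times V(H)$, and $(u,v)$ and $(x,y)$ are adjacent iff either $u$ is adjacent to $x$ in $G$, or $u=x$ and $v$ is adjacent to $y$ in $H$. *)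

theory Defs
  imports "Graph_Theory.Graph_Theory"
begin

text \<open>
  Finite simple graphs are rendered by the locale \<^locale>\<open>pair_graph\<close>: finite, loop-free,
  symmetric digraphs whose arcs are pairs of vertices, so that every undirected edge is present
  as two opposite arcs. The null graph is allowed.
\<close>

definition repetition :: "'c list \<Rightarrow> bool" where
  "repetition r \<longleftrightarrow>
     (\<exists>n\<ge>1. length r = 2 * n \<and> (\<forall>i<n. r ! i = r ! (n + i)))"

definition nonrepetitive :: "'a pair_pre_digraph \<Rightarrow> ('a \<Rightarrow> 'c) \<Rightarrow> bool" where
  "nonrepetitive G \<phi> \<longleftrightarrow>
     (\<forall>p. vpath p (with_proj G) \<longrightarrow> \<not> repetition (map \<phi> p))"

text \<open>
  Only the colours that occur on vertices are counted. Taking colours in \<^typ>\<open>nat\<close> is no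
  restriction for finite graphs, and the minimum exists by \<open>thue_number_attained\<close> below.
\<close>

definition thue_number :: "'a pair_pre_digraph \<Rightarrow> nat" where
  "thue_number G =
     (LEAST k. \<exists>\<phi> :: 'a \<Rightarrow> nat. nonrepetitive G \<phi> \<and> card (\<phi> ` pverts G) = k)"

definition independent_set :: "'a pair_pre_digraph \<Rightarrow> 'a set \<Rightarrow> bool" where
  "independent_set G S \<longleftrightarrow>
     S \<subseteq> pverts G \<and> (\<forall>u\<in>S. \<forall>v\<in>S. (u, v) \<notin> parcs G)"

definition independence_number :: "'a pair_pre_digraph \<Rightarrow> nat" where
  "independence_number G = Max (card ` {S. independent_set G S})"

definition lexicographic_product ::
  "'a pair_pre_digraph \<Rightarrow> 'b pair_pre_digraph \<Rightarrow> ('a \<times> 'b) pair_pre_digraph" where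
  "lexicographic_product G H =
     \<lparr> pverts = pverts G \<times> pverts H,
       parcs = {((u, v), (x, y)) | u v x y.
         (u, v) \<in> pverts G \<times> pverts H \<and> (x, y) \<in> pverts G \<times> pverts H \<and>
         ((u, x) \<in> parcs G \<or> u = x \<and> (v, y) \<in> parcs H)} \<rparr>"

lemma pair_graph_lexicographic_product:
  assumes "pair_graph G" "pair_graph H"
  shows "pair_graph (lexicographic_product G H)"
proof -
  interpret G: pair_graph G by fact
  interpret H: pair_graph H by fact
  have sub: "parcs (lexicographic_product G H) \<subseteq> (pverts G \<times> pverts H) \<times> (pverts G \<times> pverts H)"
    by (auto simp: lexicographic_product_def)
  have fin: "finite (pverts G \<times> pverts H)"
    using G.pair_finite_verts H.pair_finite_verts by simp
  show ?thesis
  proof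
    show "finite (pverts (lexicographic_product G H))"
      using fin by (simp add: lexicographic_product_def)
    show "finite (parcs (lexicographic_product G H))"
      using finite_subset[OF sub] fin by simp
    show "fst e \<noteq> snd e" if "e \<in> parcs (lexicographic_product G H)" for e
      using that G.pair_no_loops H.pair_no_loops by (fastforce simp: lexicographic_product_def)
    show "symmetric (with_proj (lexicographic_product G H))"
      using G.arcs_symmetric H.arcs_symmetric
      by (auto simp: symmetric_def sym_def lexicographic_product_def)
  qed (auto simp: lexicographic_product_def)
qed

lemma thue_number_attained:
  assumes "finite (pverts G)"
  shows "\<exists>\<phi> :: 'a \<Rightarrow> nat. nonrepetitive G \<phi> \<and> card (\<phi> ` pverts G) = thue_number G"
proof -
  obtain \<phi> :: "'a \<Rightarrow> nat" where inj: "inj_on \<phi> (pverts G)"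
    using finite_imp_inj_to_nat_seg[OF assms] by blast
  have "nonrepetitive G \<phi>"
    unfolding nonrepetitive_def
  proof (intro allI impI notI)
    fix p assume p: "vpath p (with_proj G)" and "repetition (map \<phi> p)"
    then obtain n where n: "n \<ge> 1" "length p = 2 * n" "map \<phi> p ! 0 = map \<phi> p ! n"
      by (fastforce simp: repetition_def)
    from p have "set p \<subseteq> pverts G" "distinct p" by (auto simp: vpath_def vwalk_def)
    with inj have "distinct (map \<phi> p)" by (auto simp: distinct_map intro: inj_on_subset)
    from nth_eq_iff_index_eq[OF this, of 0 n] n show False by simp
  qed
  then have "\<exists>k. \<exists>\<phi> :: 'a \<Rightarrow> nat. nonrepetitive G \<phi> \<and> card (\<phi> ` pverts G) = k"
    by blast
  then show ?thesis unfolding thue_number_def by (rule LeastI_ex)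
qed

lemma
  assumes "finite (pverts G)"
  shows independence_number_attained:
      "\<exists>S. independent_set G S \<and> card S = independence_number G"
    and card_independent_set_le: "independent_set G S \<Longrightarrow> card S \<le> independence_number G"
    and independence_number_le: "independence_number G \<le> card (pverts G)"
proof -
  have fin: "finite (card ` {S. independent_set G S})"
    using assms by (auto simp: independent_set_def)
  moreover have "independent_set G {}" by (simp add: independent_set_def)
  ultimately have "independence_number G \<in> card ` {S. independent_set G S}"
    unfolding independence_number_def by (intro Max_in) auto
  then show ex: "\<exists>S. independent_set G S \<and> card S = independence_number G" by auto
  show "independent_set G S \<Longrightarrow> card S \<le> independence_number G"
    unfolding independence_number_def using fin by (intro Max_ge) auto
  show "independence_number G \<le> card (pverts G)"
    using ex card_mono[OF assms] by (metis independent_set_def)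
qed

end

theory Submission
  imports Defs
begin

text \<open>
  Fix a maximum independent set \<open>S\<close> of \<open>G\<close>. Every vertex outside \<open>S \<times> V(H)\<close> gets a private colour,
  and each copy of \<open>H\<close> over \<open>S\<close> gets the same optimal colouring of \<open>H\<close>. A repetitive path cannot
  contain a privately coloured vertex, so it stays over \<open>S\<close>; as \<open>S\<close> is independent, it stays in a
  single copy of \<open>H\<close>, where the colouring is non-repetitive.
\<close>

lemma thue_number_le:
  fixes \<phi> :: "'a \<Rightarrow> nat"
  assumes "nonrepetitive G \<phi>"
  shows "thue_number G \<le> card (\<phi> ` pverts G)"
  unfolding thue_number_def using assms by (intro Least_le) blast

lemma repetition_occurs_twice:
  assumes "repetition xs" and "i < length xs"
  obtains j where "j < length xs" "j \<noteq> i" "xs ! j = xs ! i"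
proof -
  from assms(1) obtain n where n: "n \<ge> 1" "length xs = 2 * n" "\<forall>i<n. xs ! i = xs ! (n + i)"
    by (auto simp: repetition_def)
  show ?thesis
  proof (cases "i < n")
    case True
    then show ?thesis using that[of "n + i"] n by auto
  next
    case False
    then show ?thesis using that[of "i - n"] n assms(2) by (auto simp: less_diff_conv2)
  qed
qed

text \<open>Every entry of a repetition recurs half a length away; as \<open>p\<close> is distinct,
  the other position carries another vertex.\<close>

lemma repetition_no_private_colour:
  assumes "distinct p" "repetition (map \<phi> p)" "x \<in> set p"
  obtains y where "y \<in> set p" "y \<noteq> x" "\<phi> y = \<phi> x"
proof -
  obtain i where i: "i < length p" "p ! i = x"
    using assms(3) by (auto simp: in_set_conv_nth)
  then obtain j where "j < length p" "j \<noteq> i" "\<phi> (p ! j) = \<phi> x"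
    using repetition_occurs_twice[OF assms(2), of i] by auto
  with i assms(1) show ?thesis using that[of "p ! j"] by (auto simp: nth_eq_iff_index_eq)
qed

text \<open>Between two vertices over \<open>S\<close> an arc of the product cannot come from an arc
  of \<open>G\<close>, so it keeps the first coordinate and projects to an arc of
  \<open>H\<close>.\<close>

lemma vwalk_arcs_lexicographic_product_over_independent_set:
  assumes "independent_set G S" "set p \<subseteq> S \<times> UNIV"
    and "set (vwalk_arcs p) \<subseteq> parcs (lexicographic_product G H)"
  shows "(\<forall>x\<in>set p. fst x = fst (hd p)) \<and> set (vwalk_arcs (map snd p)) \<subseteq> parcs H"
  using assms(2,3)
proof (induction p rule: vwalk_arcs.induct)
  case (3 x y p)
  then have "fst x = fst y" "(snd x, snd y) \<in> parcs H"
    using assms(1) by (auto simp: lexicographic_product_def independent_set_def)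
  with 3 show ?case by auto
qed auto

lemma vpath_lexicographic_product_over_independent_set:
  assumes "independent_set G S" "set p \<subseteq> S \<times> UNIV"
    and "vpath p (with_proj (lexicographic_product G H))"
  shows "vpath (map snd p) (with_proj H)"
proof -
  have p: "set p \<subseteq> pverts G \<times> pverts H" "p \<noteq> []" "distinct p"
    "set (vwalk_arcs p) \<subseteq> parcs (lexicographic_product G H)"
    using assms(3)
    by (auto simp: vpath_def vwalk_def lexicographic_product_def arcs_ends_def arc_to_ends_def)
  note proj = vwalk_arcs_lexicographic_product_over_independent_set[OF assms(1,2) p(4)]
  \<comment> \<open>Inside a single copy of \<open>H\<close> the second coordinate determines the
    vertex, so projecting a path repeats no vertex.\<close>
  then have "inj_on snd (set p)" by (metis inj_onI prod_eqI)
  with p proj show ?thesis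
    by (auto simp: vpath_def vwalk_def distinct_map arcs_ends_def arc_to_ends_def)
qed

text \<open>In \<open>priv\<close>, \<open>y\<close> also ranges over the vertices above
  \<open>S\<close>, so a private colour must differ from the colours of \<open>\<phi>\<close> used
  there too.\<close>

lemma nonrepetitive_lexicographic_product:
  assumes "independent_set G S" and "nonrepetitive H \<phi>"
    and over: "\<And>u v. u \<in> S \<Longrightarrow> \<chi> (u, v) = \<phi> v"
    and priv: "\<And>x y. x \<in> (pverts G - S) \<times> pverts H \<Longrightarrow> y \<in> pverts G \<times> pverts H \<Longrightarrow>
      \<chi> y = \<chi> x \<Longrightarrow> y = x"
  shows "nonrepetitive (lexicographic_product G H) \<chi>"
  unfolding nonrepetitive_def
proof (intro allI impI notI)
  fix p assume p: "vpath p (with_proj (lexicographic_product G H))" and rep: "repetition (map \<chi> p)"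
  have V: "set p \<subseteq> pverts G \<times> pverts H" and "distinct p"
    using p by (auto simp: vpath_def vwalk_def lexicographic_product_def)
  have S: "set p \<subseteq> S \<times> UNIV"
  proof (rule ccontr)
    assume "\<not> set p \<subseteq> S \<times> UNIV"
    then obtain x where "x \<in> set p" "x \<in> (pverts G - S) \<times> pverts H" using V by fastforce
    then show False
      using repetition_no_private_colour[OF \<open>distinct p\<close> rep] priv V by (metis subsetD)
  qed
  \<comment> \<open>The right-hand side stays unfused, so that \<open>map snd p\<close> remains
    visible as a path of \<open>H\<close>.\<close>
  then have "map \<chi> p = map \<phi> (map snd p)" using over by fastforce
  with rep assms(2) vpath_lexicographic_product_over_independent_set[OF assms(1) S p]
  show False by (simp add: nonrepetitive_def del: map_map)
qed

theorem theorem2p1: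
  fixes G :: "'a pair_pre_digraph" and H :: "'b pair_pre_digraph"
  assumes "pair_graph G" and "pair_graph H"
  shows "thue_number (lexicographic_product G H)
    \<le> thue_number H + (card (pverts G) - independence_number G) * card (pverts H)"
proof -
  interpret G: pair_graph G by fact
  interpret H: pair_graph H by fact
  note finG = G.pair_finite_verts and finH = H.pair_finite_verts
  obtain S where S: "independent_set G S" "card S = independence_number G"
    using independence_number_attained[OF finG] by blast
  obtain \<phi> :: "'b \<Rightarrow> nat" where \<phi>: "nonrepetitive H \<phi>" "card (\<phi> ` pverts H) = thue_number H"
    using thue_number_attained[OF finH] by blast
  define R where "R = (pverts G - S) \<times> pverts H"
  obtain \<iota> :: "'a \<times> 'b \<Rightarrow> nat" where \<iota>: "inj_on \<iota> R"
    using finite_imp_inj_to_nat_seg[of R] finG finH unfolding R_def by blast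
  \<comment> \<open>Shifting by \<open>M\<close> lifts the private colours above all colours of
    \<open>\<phi>\<close> on \<open>H\<close>. If \<open>H\<close> is null, \<open>Max\<close> is
    unspecified, but there is nothing to bound.\<close>
  define M where "M = Suc (Max (\<phi> ` pverts H))"
  have M: "\<phi> v < M" if "v \<in> pverts H" for v
    using that finH by (simp add: M_def less_Suc_eq_le)
  define \<chi> where "\<chi> x = (if fst x \<in> S then \<phi> (snd x) else M + \<iota> x)" for x
  have "nonrepetitive (lexicographic_product G H) \<chi>"
  proof (rule nonrepetitive_lexicographic_product[OF S(1) \<phi>(1)])
    fix x y assume xy: "x \<in> (pverts G - S) \<times> pverts H" "y \<in> pverts G \<times> pverts H" "\<chi> y = \<chi> x"
    \<comment> \<open>The colour of \<open>x\<close> is at least \<open>M\<close>, whereas colours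
      over \<open>S\<close> lie below \<open>M\<close>.\<close>
    then have "fst y \<notin> S" using M[of "snd y"] by (auto simp: \<chi>_def split: if_splits)
    with xy have "x \<in> R" "y \<in> R" "\<iota> y = \<iota> x" by (auto simp: \<chi>_def R_def)
    with \<iota> show "y = x" by (auto dest: inj_onD)
  qed (simp add: \<chi>_def)
  then have "thue_number (lexicographic_product G H) \<le> card (\<chi> ` (pverts G \<times> pverts H))"
    using thue_number_le by (fastforce simp: lexicographic_product_def)
  \<comment> \<open>Only an inclusion: if \<open>G\<close> is null, \<open>\<chi>\<close> takes no
    colour at all, while \<open>\<phi>\<close> may take some.\<close>
  also have "\<dots> \<le> card (\<phi> ` pverts H \<union> \<chi> ` R)"
    using finG finH by (intro card_mono) (auto simp: R_def \<chi>_def)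
  also have "\<dots> \<le> card (\<phi> ` pverts H) + card R"
    using finG finH by (intro order_trans[OF card_Un_le] add_left_mono card_image_le) (simp add: R_def)
  \<comment> \<open>Here alone the size of \<open>S\<close> matters; any independent set would give
    a valid colouring.\<close>
  also have "card R = (card (pverts G) - independence_number G) * card (pverts H)"
    using S finG card_Diff_subset[of S "pverts G"] finite_subset[of S "pverts G"]
    by (simp add: R_def card_cartesian_product independent_set_def)
  finally show ?thesis using \<phi>(2) by simp
qed

end
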